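(* Let $X$ be a reflexive Banach space, let $f,g\in X^*$, and let $\delta,\varepsilon\in[0,1)$ with $\varepsilon<(1-\delta)^2$. Then $f\perp_\delta^\varepsilon g$ in $X^*$ if and only if there exists $x\in S_X$ such that $|f(x)|\ge(1-\delta)\|f\|$ and $|g(x)|\le\frac{\varepsilon}{1-\delta}\|g\|$.
   Context: All normed linear spaces are over $\mathbb{C}$. $X^*$ is the topological dual of $X$ and $S_X$ is the unit sphere of $X$. For a normed linear space $Z$, $\delta,\varepsilon\in[0,1)$ with $\varepsilon<(1-\delta)^2$ and $u,v\in Z$, one writes $u\perp_\delta^\varepsilon v$ (in $Z$) if there exists $\Gamma\in Z^*\setminus\{0\}$ with $|\Gamma(u)|\ge(1-\delta)\|\Gamma\|\|u\|$ and $|\Gamma(v)|\le\frac{\varepsilon}{1-\delta}\|\Gamma\|\|v\|$. Here this is applied with $Z=X^*$, so $\Gamma\in X^{**}$. *)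

theory Defs
  imports "HOL-Analysis.Analysis"
begin

class complex_normed_vector = real_normed_vector +
  fixes scaleC :: "complex \<Rightarrow> 'a \<Rightarrow> 'a" (infixr \<open>*\<^sub>C\<close> 75)
  assumes scaleC_add_right: "c *\<^sub>C (x + y) = c *\<^sub>C x + c *\<^sub>C y"
    and scaleC_add_left: "(c + d) *\<^sub>C x = c *\<^sub>C x + d *\<^sub>C x"
    and scaleC_scaleC: "c *\<^sub>C d *\<^sub>C x = (c * d) *\<^sub>C x"
    and scaleC_of_real: "complex_of_real r *\<^sub>C x = r *\<^sub>R x"
    and norm_scaleC: "norm (c *\<^sub>C x) = cmod c * norm x"

text \<open>The topological dual over the complex field. It is carved out of the bounded
  \<open>\<real>\<close>-linear maps into the complex numbers, and inherits their operator norm.\<close>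

typedef (overloaded) 'a cdual =
    "{F :: 'a::complex_normed_vector \<Rightarrow>\<^sub>L complex.
       \<forall>c x. blinfun_apply F (c *\<^sub>C x) = c * blinfun_apply F x}"
  morphisms blinfun_of_cdual cdual_of_blinfun
  by (rule exI[of _ 0]) simp

setup_lifting type_definition_cdual

lift_definition cdual_apply :: "'a::complex_normed_vector cdual \<Rightarrow> 'a \<Rightarrow> complex"
  is blinfun_apply .

instantiation cdual :: (complex_normed_vector) real_normed_vector
begin

lift_definition zero_cdual :: "'a cdual" is 0 by simp
lift_definition plus_cdual :: "'a cdual \<Rightarrow> 'a cdual \<Rightarrow> 'a cdual" is "(+)"
  by (simp add: blinfun.add_left algebra_simps)
lift_definition minus_cdual :: "'a cdual \<Rightarrow> 'a cdual \<Rightarrow> 'a cdual" is "(-)"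
  by (simp add: blinfun.diff_left algebra_simps)
lift_definition uminus_cdual :: "'a cdual \<Rightarrow> 'a cdual" is uminus
  by (simp add: blinfun.minus_left)
lift_definition scaleR_cdual :: "real \<Rightarrow> 'a cdual \<Rightarrow> 'a cdual" is "(*\<^sub>R)"
  by (simp add: blinfun.scaleR_left)
lift_definition norm_cdual :: "'a cdual \<Rightarrow> real" is norm .

definition dist_cdual :: "'a cdual \<Rightarrow> 'a cdual \<Rightarrow> real"
  where "dist_cdual f g = norm (f - g)"
definition sgn_cdual :: "'a cdual \<Rightarrow> 'a cdual"
  where "sgn_cdual f = inverse (norm f) *\<^sub>R f"
definition uniformity_cdual :: "('a cdual \<times> 'a cdual) filter"
  where "uniformity_cdual = (INF e\<in>{0<..}. principal {(f, g). dist f g < e})"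
definition open_cdual :: "'a cdual set \<Rightarrow> bool"
  where "open_cdual U = (\<forall>f\<in>U. \<forall>\<^sub>F (f', g) in uniformity. f' = f \<longrightarrow> g \<in> U)"

instance
proof
  fix f g h :: "'a cdual" and a b :: real
  show "f + g + h = f + (g + h)" by transfer simp
  show "f + g = g + f" by transfer simp
  show "0 + f = f" by transfer simp
  show "- f + f = 0" by transfer simp
  show "f - g = f + - g" by transfer simp
  show "a *\<^sub>R (f + g) = a *\<^sub>R f + a *\<^sub>R g" by transfer (simp add: scaleR_add_right)
  show "(a + b) *\<^sub>R f = a *\<^sub>R f + b *\<^sub>R f" by transfer (simp add: scaleR_add_left)
  show "a *\<^sub>R b *\<^sub>R f = (a * b) *\<^sub>R f" by transfer simp
  show "1 *\<^sub>R f = f" by transfer simp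
  show "norm f = 0 \<longleftrightarrow> f = 0" by transfer simp
  show "norm (f + g) \<le> norm f + norm g" by transfer (rule norm_triangle_ineq)
  show "norm (a *\<^sub>R f) = \<bar>a\<bar> * norm f" by transfer simp
qed (simp_all add: dist_cdual_def sgn_cdual_def uniformity_cdual_def open_cdual_def)

end

lemma cdual_eqI: "(\<And>x. cdual_apply f x = cdual_apply g x) \<Longrightarrow> f = g"
  by transfer (auto intro: blinfun_eqI)

lemma cdual_apply_scaleC: "cdual_apply f (c *\<^sub>C x) = c * cdual_apply f x"
  by transfer simp

lemma cdual_apply_add_left: "cdual_apply (f + g) x = cdual_apply f x + cdual_apply g x"
  by transfer (simp add: blinfun.add_left)

lemma cdual_apply_scaleR_left: "cdual_apply (r *\<^sub>R f) x = r *\<^sub>R cdual_apply f x"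
  by transfer (simp add: blinfun.scaleR_left)

lemma norm_cdual_apply: "cmod (cdual_apply f x) \<le> norm f * norm x"
  by transfer (rule norm_blinfun)

lemma norm_cdual_bound:
  "0 \<le> b \<Longrightarrow> (\<And>x. cmod (cdual_apply f x) \<le> b * norm x) \<Longrightarrow> norm f \<le> b"
  by transfer (rule norm_blinfun_bound)

instantiation cdual :: (complex_normed_vector) complex_normed_vector
begin

lift_definition scaleC_cdual :: "complex \<Rightarrow> 'a cdual \<Rightarrow> 'a cdual"
  is "\<lambda>c F. blinfun_mult_right c o\<^sub>L F"
  by simp

lemma cdual_apply_scaleC_left: "cdual_apply (c *\<^sub>C f) x = c * cdual_apply f x"
  by transfer simp

instance
proof
  fix f g :: "'a cdual" and c d :: complex and r :: real
  note [simp] = cdual_apply_scaleC_left cdual_apply_add_left cdual_apply_scaleR_left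
  show "c *\<^sub>C (f + g) = c *\<^sub>C f + c *\<^sub>C g" 
    by (rule cdual_eqI) (simp add: algebra_simps)
  show "(c + d) *\<^sub>C f = c *\<^sub>C f + d *\<^sub>C f"
    by (rule cdual_eqI) (simp add: algebra_simps)
  show assoc: "c *\<^sub>C d *\<^sub>C f = (c * d) *\<^sub>C f" for c d and f :: "'a cdual"
    by (rule cdual_eqI) simp
  show real: "complex_of_real r *\<^sub>C f = r *\<^sub>R f" for r and f :: "'a cdual"
    by (rule cdual_eqI) (simp add: scaleR_conv_of_real)
  have le: "norm (c *\<^sub>C f) \<le> cmod c * norm f" for c and f :: "'a cdual"
    by (rule norm_cdual_bound)
      (auto simp: norm_mult mult.assoc intro!: mult_left_mono norm_cdual_apply)
  show "norm (c *\<^sub>C f) = cmod c * norm f"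
  proof (cases "c = 0")
    case True
    then show ?thesis using real[of 0 f] by simp
  next
    case False
    have "f = inverse c *\<^sub>C c *\<^sub>C f"
      using False real[of 1 f] by (simp add: assoc)
    then have "norm f \<le> cmod (inverse c) * norm (c *\<^sub>C f)"
      using le[of "inverse c" "c *\<^sub>C f"] by simp
    then have "cmod c * norm f \<le> norm (c *\<^sub>C f)"
      using False by (simp add: norm_inverse norm_divide field_simps)
    with le[of c f] show ?thesis by simp
  qed
qed

end

lemma bounded_linear_cdual_apply: "bounded_linear (\<lambda>f. cdual_apply f x)"
  by (rule bounded_linear_intro[where K = "norm x"])
    (simp_all add: cdual_apply_add_left cdual_apply_scaleR_left norm_cdual_apply)

definition canonical_embedding :: "'a::complex_normed_vector \<Rightarrow> 'a cdual cdual"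
  where "canonical_embedding x = cdual_of_blinfun (Blinfun (\<lambda>f. cdual_apply f x))"

lemma canonical_embedding_apply:
  "cdual_apply (canonical_embedding x) f = cdual_apply f x"
proof -
  let ?E = "Blinfun (\<lambda>f. cdual_apply f x)"
  have E: "blinfun_apply ?E f = cdual_apply f x" for f
    by (simp add: bounded_linear_Blinfun_apply[OF bounded_linear_cdual_apply])
  then have "blinfun_of_cdual (cdual_of_blinfun ?E) = ?E"
    by (intro cdual_of_blinfun_inverse) (simp add: cdual_apply_scaleC_left)
  then have "cdual_apply (canonical_embedding x) f = blinfun_apply ?E f"
    unfolding canonical_embedding_def cdual_apply.rep_eq[of "cdual_of_blinfun ?E"] by simp
  then show ?thesis
    by (simp only: E)
qed

definition reflexive_space :: "'a::complex_normed_vector itself \<Rightarrow> bool"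
  where "reflexive_space _ \<longleftrightarrow> surj (canonical_embedding :: 'a \<Rightarrow> 'a cdual cdual)"

text \<open>Only meaningful for \<open>\<delta>, \<epsilon> \<in> [0, 1)\<close> with \<open>\<epsilon> < (1 - \<delta>)\<^sup>2\<close>.\<close>

definition approx_orth :: "real \<Rightarrow> real \<Rightarrow> 'a::complex_normed_vector \<Rightarrow> 'a \<Rightarrow> bool"
  where "approx_orth \<delta> \<epsilon> u v \<longleftrightarrow>
    (\<exists>\<Gamma> :: 'a cdual. \<Gamma> \<noteq> 0 \<and>
      cmod (cdual_apply \<Gamma> u) \<ge> (1 - \<delta>) * norm \<Gamma> * norm u \<and>
      cmod (cdual_apply \<Gamma> v) \<le> \<epsilon> / (1 - \<delta>) * norm \<Gamma> * norm v)"

end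

theory Submission imports Defs
begin

text \<open>
  By reflexivity the functionals \<open>\<Gamma>\<close> on the dual are exactly the evaluations at points \<open>z\<close>
  of \<open>X\<close>. Both inequalities that define approximate orthogonality are homogeneous in \<open>\<Gamma>\<close>,
  so the witness may be rescaled from \<open>z \<noteq> 0\<close> to \<open>z / \<parallel>z\<parallel>\<close>. The two sides of the
  equivalence then agree, provided that evaluation at \<open>z\<close> has norm exactly \<open>\<parallel>z\<parallel>\<close>
  (\<open>norm_canonical_embedding\<close>). This cannot be read off from surjectivity of the canonical
  embedding, which would hold trivially if the dual were \<open>0\<close>: one needs norming functionals,
  that is, the Hahn--Banach theorem.

  The real form of that theorem (\<open>sublinear_dominates_linear\<close>) is obtained without extending
  partially defined functionals. Zorn's lemma provides a minimal sublinear functional below a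
  given one, and minimality forces linearity: for each direction \<open>y\<close> one can push a sublinear
  functional \<open>p\<close> down to another one, \<open>tilt p y\<close>, which satisfies
  \<open>tilt p y x \<le> p (x + y) - p y\<close>. If \<open>p\<close> is minimal, it equals this tilt, so
  \<open>p x + p y \<le> p (x + y)\<close>. The same tilt, applied once before Zorn's lemma, makes the linear
  functional agree with the given sublinear one at a prescribed point.
\<close>

section \<open>Sublinear functionals and their infima\<close>

definition sublinear :: "('a::real_vector \<Rightarrow> real) \<Rightarrow> bool"
  where "sublinear p \<longleftrightarrow>
    (\<forall>x y. p (x + y) \<le> p x + p y) \<and> (\<forall>c x. 0 \<le> c \<longrightarrow> p (c *\<^sub>R x) = c * p x)"

lemma sublinear_add: "sublinear p \<Longrightarrow> p (x + y) \<le> p x + p y"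
  by (simp add: sublinear_def)

lemma sublinear_scaleR: "sublinear p \<Longrightarrow> 0 \<le> c \<Longrightarrow> p (c *\<^sub>R x) = c * p x"
  by (simp add: sublinear_def)

lemma sublinear_zero: "sublinear p \<Longrightarrow> p 0 = 0"
  using sublinear_scaleR[of p 0 0] by simp

lemma sublinear_minus: "sublinear p \<Longrightarrow> - p (- x) \<le> p x"
  using sublinear_add[of p x "- x"] sublinear_zero[of p] by simp

lemma sublinear_norm: "sublinear (norm :: 'a::real_normed_vector \<Rightarrow> real)"
  by (simp add: sublinear_def norm_triangle_ineq)

text \<open>
  The inequality for positive factors already gives homogeneity, since it can also be applied
  to the inverse factor.
\<close>

lemma sublinearI:
  assumes add: "\<And>x y. p (x + y) \<le> p x + p y"
    and scale: "\<And>c x. 0 < c \<Longrightarrow> p (c *\<^sub>R x) \<le> c * p x"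
    and zero: "p 0 = 0"
  shows "sublinear p"
  unfolding sublinear_def
proof (intro conjI allI impI)
  fix c :: real and x
  assume "0 \<le> c"
  show "p (c *\<^sub>R x) = c * p x"
  proof (cases "c = 0")
    case False
    with \<open>0 \<le> c\<close> have c: "0 < c" by simp
    then have "p x \<le> inverse c * p (c *\<^sub>R x)"
      using scale[of "inverse c" "c *\<^sub>R x"] by simp
    then have "c * p x \<le> p (c *\<^sub>R x)"
      using c by (simp add: field_simps)
    with scale[OF c, of x] show ?thesis by simp
  qed (simp add: zero)
qed (rule add)

text \<open>
  An infimum of functions inherits sublinearity even if the defining inequalities hold only up
  to a change of index. This covers both infima needed below: over a chain of sublinear
  functionals, and over the parameter of a tilt.
\<close>

lemma sublinear_INF:
  fixes \<phi> :: "'i \<Rightarrow> 'a::real_vector \<Rightarrow> real"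
  assumes ne: "I \<noteq> {}"
    and bdd: "\<And>x. bdd_below ((\<lambda>i. \<phi> i x) ` I)"
    and add: "\<And>i j x y. i \<in> I \<Longrightarrow> j \<in> I \<Longrightarrow> \<exists>k\<in>I. \<phi> k (x + y) \<le> \<phi> i x + \<phi> j y"
    and scale: "\<And>i c x. i \<in> I \<Longrightarrow> 0 < c \<Longrightarrow> \<exists>k\<in>I. \<phi> k (c *\<^sub>R x) \<le> c * \<phi> i x"
    and zero: "\<And>i. i \<in> I \<Longrightarrow> \<phi> i 0 = 0"
  shows "sublinear (\<lambda>x. INF i\<in>I. \<phi> i x)"
proof (rule sublinearI)
  fix x y
  have le: "(INF k\<in>I. \<phi> k (x + y)) \<le> \<phi> i x + \<phi> j y" if "i \<in> I" "j \<in> I" for i j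
    using add[OF that, of x y] cINF_lower[OF bdd] by (meson order_trans)
  have "(INF k\<in>I. \<phi> k (x + y)) - \<phi> j y \<le> (INF i\<in>I. \<phi> i x)" if "j \<in> I" for j
    by (rule cINF_greatest[OF ne]) (use le that in \<open>simp add: diff_le_eq\<close>)
  then have "(INF k\<in>I. \<phi> k (x + y)) - (INF i\<in>I. \<phi> i x) \<le> (INF j\<in>I. \<phi> j y)"
    by (intro cINF_greatest[OF ne]) (simp add: algebra_simps)
  then show "(INF k\<in>I. \<phi> k (x + y)) \<le> (INF i\<in>I. \<phi> i x) + (INF j\<in>I. \<phi> j y)"
    by simp
next
  fix c :: real and x
  assume c: "0 < c"
  have "(INF k\<in>I. \<phi> k (c *\<^sub>R x)) \<le> c * \<phi> i x" if "i \<in> I" for i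
    using scale[OF that c, of x] cINF_lower[OF bdd] by (meson order_trans)
  then have "(INF k\<in>I. \<phi> k (c *\<^sub>R x)) / c \<le> (INF i\<in>I. \<phi> i x)"
    by (intro cINF_greatest[OF ne]) (simp add: pos_divide_le_eq[OF c] mult.commute)
  then show "(INF k\<in>I. \<phi> k (c *\<^sub>R x)) \<le> c * (INF i\<in>I. \<phi> i x)"
    by (simp add: pos_divide_le_eq[OF c] mult.commute)
next
  show "(INF i\<in>I. \<phi> i 0) = 0"
    using ne zero by simp
qed

section \<open>Tilting a sublinear functional\<close>

definition tilt :: "('a::real_vector \<Rightarrow> real) \<Rightarrow> 'a \<Rightarrow> 'a \<Rightarrow> real"
  where "tilt p y x = (INF t\<in>{0..}. p (x + t *\<^sub>R y) - t * p y)"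

text \<open>
  The infimum is finite because \<open>t * p y = p (t *\<^sub>R y) \<le> p (x + t *\<^sub>R y) + p (- x)\<close>.
\<close>

lemma bdd_below_tilt:
  assumes "sublinear p"
  shows "bdd_below ((\<lambda>t. p (x + t *\<^sub>R y) - t * p y) ` {0..})"
proof (rule bdd_belowI2)
  fix t :: real
  assume "t \<in> {0..}"
  then show "- p (- x) \<le> p (x + t *\<^sub>R y) - t * p y"
    using sublinear_add[OF assms, of "x + t *\<^sub>R y" "- x"] sublinear_scaleR[OF assms, of t y]
    by simp
qed

lemma tilt_le:
  assumes "sublinear p" and "0 \<le> t"
  shows "tilt p y x \<le> p (x + t *\<^sub>R y) - t * p y"
  unfolding tilt_def using assms by (intro cINF_lower[OF bdd_below_tilt]) simp_all

lemma sublinear_tilt: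
  assumes p: "sublinear p"
  shows "sublinear (tilt p y)"
  unfolding tilt_def
proof (rule sublinear_INF)
  fix s t :: real and x z
  assume st: "s \<in> {0..}" "t \<in> {0..}"
  have "p (x + z + (s + t) *\<^sub>R y) \<le> p (x + s *\<^sub>R y) + p (z + t *\<^sub>R y)"
    using sublinear_add[OF p, of "x + s *\<^sub>R y" "z + t *\<^sub>R y"] by (simp add: algebra_simps)
  then show "\<exists>k\<in>{0..}. p (x + z + k *\<^sub>R y) - k * p y
      \<le> (p (x + s *\<^sub>R y) - s * p y) + (p (z + t *\<^sub>R y) - t * p y)"
    using st by (intro bexI[of _ "s + t"]) (simp_all add: algebra_simps)
next
  fix t c :: real and x
  assume t: "t \<in> {0..}" and c: "0 < c"
  have "p (c *\<^sub>R x + (c * t) *\<^sub>R y) = c * p (x + t *\<^sub>R y)"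
    using sublinear_scaleR[OF p, of c "x + t *\<^sub>R y"] c by (simp add: scaleR_add_right)
  then show "\<exists>k\<in>{0..}. p (c *\<^sub>R x + k *\<^sub>R y) - k * p y \<le> c * (p (x + t *\<^sub>R y) - t * p y)"
    using t c by (intro bexI[of _ "c * t"]) (simp_all add: algebra_simps)
qed (simp_all add: bdd_below_tilt[OF p] sublinear_scaleR[OF p])

section \<open>Hahn--Banach by minimal sublinear functionals\<close>

text \<open>
  A lower bound of a chain is its pointwise infimum, which stays finite because every
  sublinear \<open>q \<le> p\<close> satisfies \<open>- p (- x) \<le> - q (- x) \<le> q x\<close>.
\<close>

lemma exists_minimal_sublinear:
  assumes p: "sublinear p"
  obtains q where "sublinear q" "q \<le> p" "\<And>r. sublinear r \<Longrightarrow> r \<le> q \<Longrightarrow> r = q"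
proof -
  let ?A = "{q. sublinear q \<and> q \<le> p}"
  let ?R = "relation_of (\<ge>) ?A"
  have "\<exists>m\<in>?A. \<forall>a\<in>?A. m \<ge> a \<longrightarrow> a = m"
  proof (rule predicate_Zorn)
    show "partial_order_on ?A ?R"
      by (rule partial_order_on_relation_ofI) auto
  next
    fix C
    assume "C \<in> Chains ?R"
    then have sub: "C \<subseteq> ?A" and tot: "\<And>q r. q \<in> C \<Longrightarrow> r \<in> C \<Longrightarrow> q \<le> r \<or> r \<le> q"
      by (auto simp: Chains_def relation_of_def)
    show "\<exists>u\<in>?A. \<forall>a\<in>C. a \<ge> u"
    proof (cases "C = {}")
      case True
      then show ?thesis using p by auto
    next
      case False
      have sl: "sublinear q" and le: "q x \<le> p x" if "q \<in> C" for q x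
        using sub that by (auto simp: le_fun_def)
      have bdd: "bdd_below ((\<lambda>q. q x) ` C)" for x
      proof (rule bdd_belowI2)
        fix q
        assume "q \<in> C"
        then show "- p (- x) \<le> q x"
          using sublinear_minus[OF sl, of q x] le[of q "- x"] by linarith
      qed
      let ?u = "\<lambda>x. INF q\<in>C. q x"
      have lower: "?u \<le> q" if "q \<in> C" for q
        using cINF_lower[OF bdd that] by (simp add: le_fun_def)
      have "sublinear ?u"
      proof (rule sublinear_INF[OF False bdd])
        fix q r x y
        assume q: "q \<in> C" and r: "r \<in> C"
        \<comment> \<open>The smaller of the two chain members serves both summands.\<close>
        from tot[OF q r] show "\<exists>k\<in>C. k (x + y) \<le> q x + r y"
        proof
          assume "q \<le> r"
          then show ?thesis
            using q sublinear_add[OF sl[OF q], of x y]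
            by (intro bexI[of _ q]) (auto simp: le_fun_def dest: spec[of _ y])
        next
          assume "r \<le> q"
          then show ?thesis
            using r sublinear_add[OF sl[OF r], of x y]
            by (intro bexI[of _ r]) (auto simp: le_fun_def dest: spec[of _ x])
        qed
      next
        fix q x and c :: real
        assume "q \<in> C" "0 < c"
        then show "\<exists>k\<in>C. k (c *\<^sub>R x) \<le> c * q x"
          using sublinear_scaleR[OF sl, of q c x] by (intro bexI[of _ q]) simp_all
      qed (rule sublinear_zero[OF sl])
      moreover have "?u \<le> p"
        using False lower sub by (blast intro: order_trans)
      ultimately show ?thesis
        using lower by blast
    qed
  qed
  then show ?thesis
    using that by (auto intro: order_trans)
qed

text \<open>
  A minimal \<open>q\<close> coincides with its tilt in every direction, and the value of the tilt is
  bounded by the parameter \<open>1\<close>.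
\<close>

lemma minimal_sublinear_linear:
  assumes q: "sublinear q" and min: "\<And>r. sublinear r \<Longrightarrow> r \<le> q \<Longrightarrow> r = q"
  shows "linear q"
proof -
  have "tilt q y \<le> q" for y
    using tilt_le[OF q, of 0 y] by (simp add: le_fun_def)
  then have tilt: "tilt q y = q" for y
    by (intro min sublinear_tilt[OF q])
  have add: "q (x + y) = q x + q y" for x y
    using tilt_le[OF q, of 1 y x] sublinear_add[OF q, of x y] by (simp add: tilt)
  have neg: "q (- x) = - q x" for x
    using add[of x "- x"] sublinear_zero[OF q] by simp
  show ?thesis
  proof (rule linearI)
    show "q (c *\<^sub>R x) = c *\<^sub>R q x" for c x
    proof (cases "0 \<le> c")
      case False
      then show ?thesis
        using sublinear_scaleR[OF q, of "- c" x] neg[of "c *\<^sub>R x"] by simp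
    qed (simp add: sublinear_scaleR[OF q])
  qed (rule add)
qed

text \<open>
  Tilting \<open>p\<close> towards \<open>x\<^sub>0\<close> lowers its value at \<open>- x\<^sub>0\<close> to at most \<open>- p x\<^sub>0\<close>. Any linear
  functional below the tilt is therefore at least \<open>p x\<^sub>0\<close> at \<open>x\<^sub>0\<close>.
\<close>

theorem sublinear_dominates_linear:
  assumes p: "sublinear p"
  obtains q where "linear q" "\<And>x. q x \<le> p x" "q x\<^sub>0 = p x\<^sub>0"
proof -
  obtain q where q: "sublinear q" and le: "q \<le> tilt p x\<^sub>0"
    and min: "\<And>r. sublinear r \<Longrightarrow> r \<le> q \<Longrightarrow> r = q"
    using exists_minimal_sublinear[OF sublinear_tilt[OF p]] by blast
  have lin: "linear q"
    by (rule minimal_sublinear_linear[OF q min])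
  have le_tilt: "q x \<le> tilt p x\<^sub>0 x" for x
    using le by (simp add: le_fun_def)
  have le_p: "q x \<le> p x" for x
    using le_tilt[of x] tilt_le[OF p, of 0 x\<^sub>0 x] by simp
  have "q (- x\<^sub>0) \<le> - p x\<^sub>0"
    using le_tilt[of "- x\<^sub>0"] tilt_le[OF p, of 1 x\<^sub>0 "- x\<^sub>0"] sublinear_zero[OF p] by simp
  then have "q x\<^sub>0 = p x\<^sub>0"
    using le_p[of x\<^sub>0] linear_neg[OF lin, of x\<^sub>0] by simp
  with lin le_p show ?thesis
    using that by blast
qed

section \<open>Norming functionals over the complex field\<close>

lemma exists_cdual_eq:
  fixes F :: "'a::complex_normed_vector \<Rightarrow> complex"
  assumes add: "\<And>x y. F (x + y) = F x + F y"
    and scale: "\<And>c x. F (c *\<^sub>C x) = c * F x"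
    and bound: "\<And>x. cmod (F x) \<le> K * norm x"
  obtains f where "\<And>x. cdual_apply f x = F x"
proof -
  have "F (r *\<^sub>R x) = r *\<^sub>R F x" for r x
    using scale[of "complex_of_real r" x] by (simp add: scaleC_of_real scaleR_conv_of_real)
  then have "bounded_linear F"
    using add bound by (intro bounded_linear_intro[where K = K]) (simp_all add: mult.commute)
  then have B: "blinfun_apply (Blinfun F) = F"
    by (rule bounded_linear_Blinfun_apply)
  then have "blinfun_of_cdual (cdual_of_blinfun (Blinfun F)) = Blinfun F"
    by (intro cdual_of_blinfun_inverse) (simp add: scale)
  then have "cdual_apply (cdual_of_blinfun (Blinfun F)) x = F x" for x
    by (simp add: cdual_apply.rep_eq B)
  then show ?thesis
    using that by blast
qed

text \<open>
  A real-linear \<open>q\<close> is the real part of the complex-linear functional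
  \<open>F x = q x - \<i> * q (\<i> *\<^sub>C x)\<close>. Rotating \<open>x\<close> by a unit scalar makes \<open>F x\<close> real and
  nonnegative, so the bound \<open>q \<le> norm\<close> passes to \<open>\<bar>F\<bar>\<close>.
\<close>

lemma exists_norming_functional:
  fixes x\<^sub>0 :: "'a::complex_normed_vector"
  obtains f where "norm f \<le> 1" "norm x\<^sub>0 \<le> cmod (cdual_apply f x\<^sub>0)"
proof -
  obtain q :: "'a \<Rightarrow> real" where lin: "linear q" and le: "\<And>x. q x \<le> norm x"
    and q0: "q x\<^sub>0 = norm x\<^sub>0"
    using sublinear_dominates_linear[OF sublinear_norm] by blast
  define F where "F x = Complex (q x) (- q (\<i> *\<^sub>C x))" for x
  have scaleC_Re_Im: "c *\<^sub>C x = Re c *\<^sub>R x + Im c *\<^sub>R (\<i> *\<^sub>C x)" for c and x :: 'a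
  proof -
    have "c = complex_of_real (Re c) + complex_of_real (Im c) * \<i>"
      by (simp add: complex_eq_iff)
    then have "c *\<^sub>C x = (complex_of_real (Re c) + complex_of_real (Im c) * \<i>) *\<^sub>C x"
      by simp
    then show ?thesis
      by (simp only: scaleC_add_left flip: scaleC_scaleC scaleC_of_real)
  qed
  have add: "F (x + y) = F x + F y" for x y
    by (simp add: F_def complex_eq_iff scaleC_add_right linear_add[OF lin])
  have scale: "F (c *\<^sub>C x) = c * F x" for c x
  proof -
    have "\<i> *\<^sub>C c *\<^sub>C x = Re c *\<^sub>R (\<i> *\<^sub>C x) - Im c *\<^sub>R x"
      unfolding scaleC_scaleC by (subst scaleC_Re_Im) simp
    then show ?thesis
      unfolding F_def by (subst scaleC_Re_Im)
        (simp add: complex_eq_iff linear_add[OF lin] linear_diff[OF lin] linear_scale[OF lin])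
  qed
  have bound: "cmod (F x) \<le> norm x" for x
  proof (cases "F x = 0")
    case False
    define c where "c = cnj (sgn (F x))"
    have c: "cmod c = 1"
      using False by (simp add: c_def norm_sgn)
    have "c * F x = complex_of_real (cmod (F x))"
      using False complex_norm_square[of "F x"]
      by (simp add: c_def sgn_div_norm scaleR_conv_of_real field_simps power2_eq_square)
    then have "Re (F (c *\<^sub>C x)) = cmod (F x)"
      by (simp add: scale)
    then have "cmod (F x) = q (c *\<^sub>C x)"
      by (simp add: F_def)
    also have "\<dots> \<le> norm x"
      using le[of "c *\<^sub>C x"] by (simp add: norm_scaleC c)
    finally show ?thesis .
  qed simp
  obtain f where f: "\<And>x. cdual_apply f x = F x"
    using exists_cdual_eq[of F 1] add scale bound by auto
  have "norm f \<le> 1"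
    by (rule norm_cdual_bound) (simp_all add: f bound)
  moreover have "norm x\<^sub>0 \<le> cmod (cdual_apply f x\<^sub>0)"
    using complex_Re_le_cmod[of "F x\<^sub>0"] by (simp add: f F_def q0)
  ultimately show ?thesis
    using that by blast
qed

lemma norm_canonical_embedding:
  "norm (canonical_embedding x) = norm x"
proof (rule antisym)
  show "norm (canonical_embedding x) \<le> norm x"
    using norm_cdual_apply[of _ x]
    by (intro norm_cdual_bound) (simp_all add: canonical_embedding_apply mult.commute)
  obtain f where f: "norm f \<le> 1" "norm x \<le> cmod (cdual_apply f x)"
    by (rule exists_norming_functional)
  have "norm x \<le> norm (canonical_embedding x) * norm f"
    using f(2) norm_cdual_apply[of "canonical_embedding x" f]
    by (simp add: canonical_embedding_apply)
  also have "\<dots> \<le> norm (canonical_embedding x)"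
    using f(1) by (simp add: mult_left_le)
  finally show "norm x \<le> norm (canonical_embedding x)" .
qed

section \<open>Approximate orthogonality in the dual of a reflexive space\<close>

theorem corollary3p1:
  fixes f g :: "'a::{complex_normed_vector, banach} cdual"
    and \<delta> \<epsilon> :: real
  assumes "reflexive_space TYPE('a)"
    and "\<delta> \<in> {0..<1}" and "\<epsilon> \<in> {0..<1}"
    and "\<epsilon> < (1 - \<delta>)\<^sup>2"
  shows "approx_orth \<delta> \<epsilon> f g \<longleftrightarrow>
    (\<exists>x \<in> sphere (0::'a) 1.
      cmod (cdual_apply f x) \<ge> (1 - \<delta>) * norm f \<and>
      cmod (cdual_apply g x) \<le> \<epsilon> / (1 - \<delta>) * norm g)"
proof
  assume "approx_orth \<delta> \<epsilon> f g"
  then obtain \<Gamma> :: "'a cdual cdual" where \<Gamma>: "\<Gamma> \<noteq> 0"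
      "cmod (cdual_apply \<Gamma> f) \<ge> (1 - \<delta>) * norm \<Gamma> * norm f"
      "cmod (cdual_apply \<Gamma> g) \<le> \<epsilon> / (1 - \<delta>) * norm \<Gamma> * norm g"
    by (auto simp: approx_orth_def)
  obtain z :: 'a where z: "\<Gamma> = canonical_embedding z"
    using assms(1) by (auto simp: reflexive_space_def surj_def)
  have norm_\<Gamma>: "norm \<Gamma> = norm z"
    by (simp add: z norm_canonical_embedding)
  then have pos: "0 < norm z"
    using \<Gamma>(1) by (metis zero_less_norm_iff)
  define x where "x = complex_of_real (inverse (norm z)) *\<^sub>C z"
  have x: "x \<in> sphere 0 1"
    using pos unfolding x_def scaleC_of_real by simp
  have apply_x: "cmod (cdual_apply h x) = cmod (cdual_apply \<Gamma> h) / norm \<Gamma>" for h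
    unfolding x_def cdual_apply_scaleC norm_\<Gamma> by (simp add: z canonical_embedding_apply
        norm_mult norm_inverse divide_inverse mult.commute)
  have "cmod (cdual_apply f x) \<ge> (1 - \<delta>) * norm f"
    using \<Gamma>(2) pos by (simp add: apply_x norm_\<Gamma> pos_le_divide_eq mult_ac)
  moreover have "cmod (cdual_apply g x) \<le> \<epsilon> / (1 - \<delta>) * norm g"
    using \<Gamma>(3) pos unfolding apply_x norm_\<Gamma> by (simp add: pos_divide_le_eq mult_ac)
  ultimately show "\<exists>x \<in> sphere (0::'a) 1.
      cmod (cdual_apply f x) \<ge> (1 - \<delta>) * norm f \<and>
      cmod (cdual_apply g x) \<le> \<epsilon> / (1 - \<delta>) * norm g"
    using x by blast
next
  assume "\<exists>x \<in> sphere (0::'a) 1.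
      cmod (cdual_apply f x) \<ge> (1 - \<delta>) * norm f \<and>
      cmod (cdual_apply g x) \<le> \<epsilon> / (1 - \<delta>) * norm g"
  then obtain x :: 'a where "norm x = 1"
      and x: "cmod (cdual_apply f x) \<ge> (1 - \<delta>) * norm f"
        "cmod (cdual_apply g x) \<le> \<epsilon> / (1 - \<delta>) * norm g"
    by auto
  then have norm_Jx: "norm (canonical_embedding x) = 1"
    by (simp add: norm_canonical_embedding)
  then have "canonical_embedding x \<noteq> 0"
    by force
  then show "approx_orth \<delta> \<epsilon> f g"
    unfolding approx_orth_def using x norm_Jx
    by (intro exI[of _ "canonical_embedding x"]) (simp add: canonical_embedding_apply)
qed

end
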